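(* Suppose the components of $\tilde{\boldsymbol w}$ are pairwise distinct. Let $\boldsymbol y\in K(\tilde{\boldsymbol w})$ with $\boldsymbol y\ne\boldsymbol 0$, and let the minimum consecutive partitions of $\mathrm{supp}(\boldsymbol y)$ and $\mathrm{comp}(\mathrm{supp}(\boldsymbol y))$ be $$\mathrm{supp}(\boldsymbol y)=\bigcup_{j=1}^m A_j(\boldsymbol y),\qquad \mathrm{comp}(\mathrm{supp}(\boldsymbol y))=\bigcup_{j=1}^m B_j(\boldsymbol y)$$ for some $m\le k$. Then one can construct minimal SCG-tuples $(S,N,C)$ (with respect to $\tilde{\boldsymbol w}$) with $S\cup C=\mathrm{supp}(\boldsymbol y)$ as follows. (1) If $|\mathrm{supp}(\boldsymbol y)|<k$, then $(S,N,C)=(\emptyset,\ [\![d]\!]\setminus\mathrm{supp}(\boldsymbol y),\ \mathrm{supp}(\boldsymbol y))$ is a minimal SCG-tuple. (2) If $|\mathrm{supp}(\boldsymbol y)|=k$, then for every $\ell=1,\dots,m-1$, $$(S,N,C)=\Big(\bigcup_{j=\ell+1}^m A_j(\boldsymbol y),\ \bigcup_{j=1}^{\ell}B_j(\boldsymbol y),\ \bigcup_{j=1}^{\ell}A_j(\boldsymbol y)\Big)$$ is a minimal SCG-tuple. Moreover (corresponding to $\ell=m$), $(S_2,N_2,C_2)=(\emptyset,\ \mathrm{comp}(\mathrm{supp}(\boldsymbol y)),\ \mathrm{supp}(\boldsymbol y))$ is a minimal SCG-tuple; and (corresponding to $\ell=0$), if $B_1(\boldsymbol y)\ne\emptyset$,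 then $(S_1,N_1,C_1)=(\mathrm{supp}(\boldsymbol y),\emptyset,\emptyset)$ is a minimal SCG-tuple as well.
   Context: Let $d,k$ be integers with $1\le k\le d$, write $[\![d]\!]=\{1,\dots,d\}$, let $\mathcal L:\mathbb R^d\to\mathbb R$ be a convex loss and $\gamma>0$. The sparse ridge regression problem is $v^*=\min_{\boldsymbol\beta\in\mathbb R^d}\{\mathcal L(\boldsymbol\beta)+\gamma\|\boldsymbol\beta\|_2^2:\ \|\boldsymbol\beta\|_0\le k\}$, where $\|\boldsymbol\beta\|_0=|\mathrm{supp}(\boldsymbol\beta)|$, $\mathrm{supp}(\boldsymbol\beta)=\{i:\beta_i\ne 0\}$. Its relaxation value is $$v_{\rm conic}=\max_{\boldsymbol p\in\mathbb R^d}\ \min_{\boldsymbol\beta\in\mathbb R^d,\ \boldsymbol z\in[0,1]^d,\ \boldsymbol 1^\top\boldsymbol z\le k}\ \mathcal L(\boldsymbol\beta)+\gamma\sum_{i=1}^d\Big(p_i\beta_i-\frac{p_i^2z_i}{4}\Big),$$ a lower bound on $v^*$; $\hat{\boldsymbol p}$ is an optimal solution of the outer maximization, and $\hat{\boldsymbol w}=\hat{\boldsymbol p}\circ\hat{\boldsymbol p}$ (entrywise square). Let $v_{\rm ub}$ be any upper bound of $v^*$ and $\mathrm{gap}=v_{\rm ub}-v_{\rm conic}\ge0$. The vector $\tilde{\boldsymbol w}$ is the reordering of $\hat{\boldsymbol w}$ in decreasing order, so (components being distinct) $\tilde w_1>\tilde w_2>\dots>\tilde w_d\ge 0$. For a vector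 $\boldsymbol x$, $x_{[j]}$ denotes its $j$-th largest component, and $\boldsymbol x_R$ its restriction to the index set $R$. SCG-tuple: let $S,N\subseteq[\![d]\!]$ be disjoint with $|S|\le k$, let $R=[\![d]\!]\setminus(S\cup N)$ and $c=\min\{k-|S|,|R|\}$. The triple $(S,N,C)$ is an SCG-tuple with respect to $\tilde{\boldsymbol w}$ if $C=\{i\in R:\ \tilde w_i\ge(\tilde{\boldsymbol w}_R)_{[c]}\}$ (and $C=\emptyset$ if $c=0$). It is valid if in addition $\sum_{i=1}^k\tilde w_{[i]}-\sum_{i\in S}\tilde w_i-\sum_{i\in C}\tilde w_i>\frac4\gamma\,\mathrm{gap}$. A valid SCG-tuple $(S,N,C)$ is minimal (a minimal SCG-tuple) if both of the following hold: (1) $N=\emptyset$, or for every $i\in N$ the triple $(S,N\setminus\{i\},C)$ is not a valid SCG-tuple; (2) $S=\emptyset$, or for every $i\in S$ the triple $(S\setminus\{i\},N,C\cup\{i\})$ is not a valid SCG-tuple. The $k$-cardinality binary knapsack set is $K(\tilde{\boldsymbol w})=\{\boldsymbol x\in\{0,1\}^d:\ \sum_{i=1}^d\tilde w_ix_i<c(\tilde{\boldsymbol w}),\ \|\boldsymbol x\|_0\le k\}$, where $c(\tilde{\boldsymbol w})=\sum_{i=1}^k\tilde w_{[i]}-\frac4\gamma\,\mathrm{gap}$. For nonempty $A\subseteq[\![d]\!]$, $\mathrm{comp}(A)=\{i\in[\![d]\!]:\ i\notin A\text{ and there is }j\in A\text{ with }i<j\}$. A consecutive index set is a nonempty set of consecutive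 integers in $[\![d]\!]$. The minimum consecutive partition of an index set is its partition into the smallest number of disjoint consecutive index sets (e.g. $\{2,3,5,6,9\}=\{2,3\}\cup\{5,6\}\cup\{9\}$). For $\boldsymbol 0\ne\boldsymbol y\in K(\tilde{\boldsymbol w})$, $A_1(\boldsymbol y),\dots,A_m(\boldsymbol y)$ are the blocks of the minimum consecutive partition of $\mathrm{supp}(\boldsymbol y)$ listed in increasing order, and $B_j(\boldsymbol y)=\{\max A_{j-1}(\boldsymbol y)+1,\dots,\min A_j(\boldsymbol y)-1\}$ for $j=1,\dots,m$, with the convention $\max A_0(\boldsymbol y)=0$ ($B_1(\boldsymbol y)$ may be empty). *)

theory Defs
  imports "HOL-Analysis.Analysis" "HOL-Library.Disjoint_Sets"
begin

text \<open>
  Regression vectors live in \<open>real ^ 'n\<close>, whose index type carries no order.  Vectors for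
  which the order of the indices matters (the reordered weights and the knapsack points) are
  functions on \<open>nat\<close>, used only on \<open>{1..d}\<close> where \<open>d = CARD('n)\<close>.
\<close>

subsection \<open>Sparse ridge regression and its conic relaxation\<close>

definition l0_norm :: "real ^ 'n \<Rightarrow> nat" where
  "l0_norm \<beta> = card {i. \<beta> $ i \<noteq> 0}"

definition sparse_ridge_value :: "(real ^ 'n \<Rightarrow> real) \<Rightarrow> real \<Rightarrow> nat \<Rightarrow> ereal" where
  "sparse_ridge_value L \<gamma> k =
     (INF \<beta> \<in> {\<beta>. l0_norm \<beta> \<le> k}. ereal (L \<beta> + \<gamma> * (norm \<beta>)\<^sup>2))"

text \<open>
  The inner minimum may be \<open>-\<infinity>\<close> or fail to be attained for a poor choice of \<open>p\<close>;
  hence an infimum in the extended reals.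
\<close>
definition conic_inner_value :: "(real ^ 'n \<Rightarrow> real) \<Rightarrow> real \<Rightarrow> nat \<Rightarrow> real ^ 'n \<Rightarrow> ereal" where
  "conic_inner_value L \<gamma> k p =
     (INF (\<beta>, z) \<in> {(\<beta> :: real ^ 'n, z :: real ^ 'n).
                    (\<forall>i. 0 \<le> z $ i \<and> z $ i \<le> 1) \<and> (\<Sum>i\<in>UNIV. z $ i) \<le> real k}.
        ereal (L \<beta> + \<gamma> * (\<Sum>i\<in>UNIV. p $ i * \<beta> $ i - (p $ i)\<^sup>2 * z $ i / 4)))"

definition conic_value :: "(real ^ 'n \<Rightarrow> real) \<Rightarrow> real \<Rightarrow> nat \<Rightarrow> ereal" where
  "conic_value L \<gamma> k = (SUP p. conic_inner_value L \<gamma> k p)"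

definition decreasing_reordering :: "real ^ 'n \<Rightarrow> (nat \<Rightarrow> real) \<Rightarrow> bool" where
  "decreasing_reordering u w \<longleftrightarrow>
     (\<exists>\<pi>. bij_betw \<pi> {1..CARD('n)} (UNIV :: 'n set) \<and> (\<forall>i\<in>{1..CARD('n)}. w i = u $ \<pi> i)) \<and>
     (\<forall>i\<in>{1..CARD('n)}. \<forall>j\<in>{1..CARD('n)}. i \<le> j \<longrightarrow> w j \<le> w i)"

subsection \<open>SCG-tuples\<close>

text \<open>The \<open>j\<close>-th largest component, counted with multiplicity, of \<open>x\<close> restricted to \<open>R\<close>;
  meaningful for finite \<open>R\<close> and \<open>1 \<le> j \<le> card R\<close>.\<close>
definition nth_largest :: "nat set \<Rightarrow> (nat \<Rightarrow> real) \<Rightarrow> nat \<Rightarrow> real" where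
  "nth_largest R x j = rev (sort (map x (sorted_list_of_set R))) ! (j - 1)"

definition SCG_tuple :: "nat \<Rightarrow> nat \<Rightarrow> (nat \<Rightarrow> real) \<Rightarrow> nat set \<Rightarrow> nat set \<Rightarrow> nat set \<Rightarrow> bool" where
  "SCG_tuple d k w S N C \<longleftrightarrow>
     S \<subseteq> {1..d} \<and> N \<subseteq> {1..d} \<and> S \<inter> N = {} \<and> card S \<le> k \<and>
     (let R = {1..d} - (S \<union> N); c = min (k - card S) (card R)
      in C = (if c = 0 then {} else {i \<in> R. w i \<ge> nth_largest R w c}))"

definition valid_SCG_tuple ::
    "nat \<Rightarrow> nat \<Rightarrow> real \<Rightarrow> real \<Rightarrow> (nat \<Rightarrow> real) \<Rightarrow> nat set \<Rightarrow> nat set \<Rightarrow> nat set \<Rightarrow> bool" where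
  "valid_SCG_tuple d k \<gamma> gap w S N C \<longleftrightarrow>
     SCG_tuple d k w S N C \<and>
     (\<Sum>i=1..k. nth_largest {1..d} w i) - (\<Sum>i\<in>S. w i) - (\<Sum>i\<in>C. w i) > 4 / \<gamma> * gap"

definition minimal_SCG_tuple ::
    "nat \<Rightarrow> nat \<Rightarrow> real \<Rightarrow> real \<Rightarrow> (nat \<Rightarrow> real) \<Rightarrow> nat set \<Rightarrow> nat set \<Rightarrow> nat set \<Rightarrow> bool" where
  "minimal_SCG_tuple d k \<gamma> gap w S N C \<longleftrightarrow>
     valid_SCG_tuple d k \<gamma> gap w S N C \<and>
     (N = {} \<or> (\<forall>i\<in>N. \<not> valid_SCG_tuple d k \<gamma> gap w S (N - {i}) C)) \<and>
     (S = {} \<or> (\<forall>i\<in>S. \<not> valid_SCG_tuple d k \<gamma> gap w (S - {i}) N (C \<union> {i})))"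

subsection \<open>The cardinality-constrained knapsack set\<close>

definition supp :: "nat \<Rightarrow> (nat \<Rightarrow> real) \<Rightarrow> nat set" where
  "supp d x = {i \<in> {1..d}. x i \<noteq> 0}"

definition knapsack_capacity :: "nat \<Rightarrow> nat \<Rightarrow> real \<Rightarrow> real \<Rightarrow> (nat \<Rightarrow> real) \<Rightarrow> real" where
  "knapsack_capacity d k \<gamma> gap w = (\<Sum>i=1..k. nth_largest {1..d} w i) - 4 / \<gamma> * gap"

definition knapsack_set :: "nat \<Rightarrow> nat \<Rightarrow> real \<Rightarrow> real \<Rightarrow> (nat \<Rightarrow> real) \<Rightarrow> (nat \<Rightarrow> real) set" where
  "knapsack_set d k \<gamma> gap w =
     {x \<in> {1..d} \<rightarrow>\<^sub>E {0, 1}.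
        (\<Sum>i=1..d. w i * x i) < knapsack_capacity d k \<gamma> gap w \<and> card (supp d x) \<le> k}"

subsection \<open>Consecutive partitions\<close>

definition comp_set :: "nat \<Rightarrow> nat set \<Rightarrow> nat set" where
  "comp_set d A = {i \<in> {1..d}. i \<notin> A \<and> (\<exists>j\<in>A. i < j)}"

definition consecutive_set :: "nat \<Rightarrow> nat set \<Rightarrow> bool" where
  "consecutive_set d I \<longleftrightarrow> (\<exists>a b. 1 \<le> a \<and> a \<le> b \<and> b \<le> d \<and> I = {a..b})"

definition consecutive_partition :: "nat \<Rightarrow> nat set \<Rightarrow> nat set set \<Rightarrow> bool" where
  "consecutive_partition d I P \<longleftrightarrow> partition_on I P \<and> (\<forall>X\<in>P. consecutive_set d X)"

definition min_consecutive_partition :: "nat \<Rightarrow> nat set \<Rightarrow> nat set set \<Rightarrow> bool" where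
  "min_consecutive_partition d I P \<longleftrightarrow>
     consecutive_partition d I P \<and> (\<forall>Q. consecutive_partition d I Q \<longrightarrow> card P \<le> card Q)"

text \<open>The blocks of the minimum consecutive partition, listed in increasing order as
  \<open>A 1, \<dots>, A m\<close>.\<close>
definition min_consecutive_blocks :: "nat \<Rightarrow> nat set \<Rightarrow> nat \<Rightarrow> (nat \<Rightarrow> nat set) \<Rightarrow> bool" where
  "min_consecutive_blocks d I m A \<longleftrightarrow>
     min_consecutive_partition d I (A ` {1..m}) \<and>
     (\<forall>i\<in>{1..m}. \<forall>j\<in>{1..m}. i < j \<longrightarrow> Max (A i) < Min (A j))"

text \<open>The indices strictly between \<open>A (j - 1)\<close> and \<open>A j\<close>, where \<open>Max (A 0)\<close> is read as \<open>0\<close>.\<close>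
definition gap_block :: "(nat \<Rightarrow> nat set) \<Rightarrow> nat \<Rightarrow> nat set" where
  "gap_block A j = {(if j = 1 then 0 else Max (A (j - 1))) + 1 .. Min (A j) - 1}"

end

theory Submission
  imports Defs
begin

text \<open>
  For strictly decreasing weights, \<open>C\<close> is determined by \<open>S\<close> and \<open>N\<close> as the initial segment of
  \<open>R\<close> of cardinality \<open>c\<close>.  The triples in both minimality conditions have the same \<open>S \<union> C\<close> as
  the original triple, so the validity inequality always persists and minimality amounts to the
  failure of the initial segment property or of the cardinality of \<open>C\<close>.  The tuples of part (2)
  are obtained by cutting \<open>supp y\<close> at the threshold \<open>t = Max (A l)\<close>: an index released from
  \<open>N\<close> is smaller than \<open>t \<in> C\<close>, and an index moved from \<open>S\<close> to \<open>C\<close> skips the nonempty gap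
  just above \<open>t\<close>.
\<close>

subsection \<open>SCG-tuples for strictly decreasing weights\<close>

text \<open>Decreasing weights turn the increasing enumeration of \<open>R\<close> into a decreasing
  list, so \<open>rev\<close> and \<open>sort\<close> in \<open>nth_largest\<close> cancel: the
  \<open>c\<close>-th largest weight sits at the \<open>c\<close>-th smallest index.\<close>

lemma nth_largest_antimono:
  fixes w :: "nat \<Rightarrow> real"
  assumes anti: "antimono_on R w" and "finite R" "1 \<le> c" "c \<le> card R"
  shows "nth_largest R w c = w (sorted_list_of_set R ! (c - 1))"
proof -
  let ?l = "sorted_list_of_set R"
  have l: "set ?l = R" "length ?l = card R"
    using \<open>finite R\<close> by auto
  have "sorted (rev (map w ?l))"
    unfolding sorted_rev_iff_nth_mono
  proof (intro allI impI)
    fix i j assume "i \<le> j" and j: "j < length (map w ?l)"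
    have "?l ! i \<le> ?l ! j"
      using \<open>i \<le> j\<close> j by (intro sorted_nth_mono) auto
    moreover have "?l ! i \<in> R" "?l ! j \<in> R"
      using \<open>i \<le> j\<close> j nth_mem[of i ?l] nth_mem[of j ?l] \<open>finite R\<close> by auto
    ultimately have "w (?l ! j) \<le> w (?l ! i)"
      using monotone_onD[OF anti] by blast
    then show "map w ?l ! j \<le> map w ?l ! i"
      using \<open>i \<le> j\<close> j by simp
  qed
  then have "sort (map w ?l) = rev (map w ?l)"
    by (intro properties_for_sort) simp_all
  then show ?thesis
    using assms l by (simp add: nth_largest_def)
qed

text \<open>The elements counted are the first \<open>c\<close> entries of the increasing
  enumeration, which has no repetitions; list positions start at 0, hence
  \<open>c - 1\<close>.\<close>

lemma card_le_nth_sorted_list_of_set: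
  fixes R :: "nat set"
  assumes "finite R" "1 \<le> c" "c \<le> card R"
  shows "card {i \<in> R. i \<le> sorted_list_of_set R ! (c - 1)} = c"
proof -
  let ?l = "sorted_list_of_set R"
  have l: "set ?l = R" "length ?l = card R" "distinct ?l" "sorted ?l"
    using \<open>finite R\<close> by auto
  have "{i \<in> R. i \<le> ?l ! (c - 1)} = set (take c ?l)"
  proof (intro equalityI subsetI)
    fix i assume "i \<in> {i \<in> R. i \<le> ?l ! (c - 1)}"
    then obtain j where j: "j < card R" "i = ?l ! j" "?l ! j \<le> ?l ! (c - 1)"
      using l by (metis (no_types, lifting) in_set_conv_nth mem_Collect_eq)
    have "j \<le> c - 1"
    proof (rule ccontr)
      assume "\<not> j \<le> c - 1"
      then have "?l ! (c - 1) \<le> ?l ! j" "?l ! (c - 1) \<noteq> ?l ! j"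
        using j assms l(2) nth_eq_iff_index_eq[OF l(3), of "c - 1" j]
          sorted_nth_mono[OF l(4), of "c - 1" j] by simp_all
      then show False
        using j by simp
    qed
    then show "i \<in> set (take c ?l)"
      using j assms l by (auto simp: in_set_conv_nth intro!: exI[of _ j])
  next
    fix i assume "i \<in> set (take c ?l)"
    then obtain j where "j < c" "i = ?l ! j"
      by (auto simp: in_set_conv_nth)
    then show "i \<in> {i \<in> R. i \<le> ?l ! (c - 1)}"
      using assms l nth_mem[of j ?l] by (auto intro!: sorted_nth_mono)
  qed
  then show ?thesis
    using assms l by (simp add: distinct_card)
qed

text \<open>Initial segments of a linear order are comparable by inclusion, and a finite set has no
  proper subset of the same cardinality.\<close>

lemma initial_segments_eq:
  fixes C T R :: "nat set"
  assumes "finite R" "C \<subseteq> R" "T \<subseteq> R" "card C = card T"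
    and C: "\<And>i j. i \<in> C \<Longrightarrow> j \<in> R \<Longrightarrow> j < i \<Longrightarrow> j \<in> C"
    and T: "\<And>i j. i \<in> T \<Longrightarrow> j \<in> R \<Longrightarrow> j < i \<Longrightarrow> j \<in> T"
  shows "C = T"
proof -
  have "finite C" "finite T"
    using assms finite_subset by blast+
  moreover have "C \<subseteq> T \<or> T \<subseteq> C"
    using assms(2,3) C T by (metis linorder_neqE_nat subset_iff)
  ultimately show ?thesis
    using \<open>card C = card T\<close> by (metis card_subset_eq)
qed

text \<open>This eliminates \<open>nth_largest\<close>: all later arguments verify or refute an
  SCG-tuple through the cardinality of \<open>C\<close> and the initial segment property
  alone.\<close>

lemma SCG_tuple_iff:
  assumes w: "strict_antimono_on {1..d} w"
  defines "R S N \<equiv> {1..d} - (S \<union> N)"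
  shows "SCG_tuple d k w S N C \<longleftrightarrow>
    S \<subseteq> {1..d} \<and> N \<subseteq> {1..d} \<and> S \<inter> N = {} \<and> card S \<le> k \<and> C \<subseteq> R S N \<and>
    card C = min (k - card S) (card (R S N)) \<and> (\<forall>i\<in>C. \<forall>j\<in>R S N. j < i \<longrightarrow> j \<in> C)"
proof -
  define Q where "Q = R S N"
  define c where "c = min (k - card S) (card Q)"
  \<comment> \<open>\<open>T\<close> is the value that \<open>SCG_tuple\<close> prescribes for
    \<open>C\<close>; it turns out to be the only initial segment of \<open>Q\<close> with
    \<open>c\<close> elements.\<close>
  define T where "T = (if c = 0 then {} else {i \<in> Q. w i \<ge> nth_largest Q w c})"
  have Q: "Q \<subseteq> {1..d}" "finite Q"
    by (auto simp: Q_def R_def)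
  have T: "T \<subseteq> Q \<and> card T = c \<and> (\<forall>i\<in>T. \<forall>j\<in>Q. j < i \<longrightarrow> j \<in> T)"
  proof (cases "c = 0")
    case False
    then have c: "1 \<le> c" "c \<le> card Q"
      by (auto simp: c_def)
    define t where "t = sorted_list_of_set Q ! (c - 1)"
    have t: "t \<in> Q"
      using c Q nth_mem[of "c - 1" "sorted_list_of_set Q"] by (simp add: t_def)
    have "antimono_on Q w"
      using w Q(1) unfolding monotone_on_def by (metis le_less subset_iff)
    then have "nth_largest Q w c = w t"
      using Q c by (simp add: nth_largest_antimono t_def)
    \<comment> \<open>Strictness excludes ties, so the cut by weight is a cut by position and
      selects exactly \<open>c\<close> indices.\<close>
    moreover have "w t \<le> w i \<longleftrightarrow> i \<le> t" if "i \<in> Q" for i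
      using w Q(1) t that unfolding monotone_on_def
      by (metis leD le_less linorder_neqE_nat subset_iff not_le)
    ultimately have "T = {i \<in> Q. i \<le> t}"
      using False by (auto simp: T_def)
    then show ?thesis
      using card_le_nth_sorted_list_of_set[OF Q(2) c] by (auto simp: t_def)
  qed (simp add: T_def)
  have "C = T \<longleftrightarrow> C \<subseteq> Q \<and> card C = c \<and> (\<forall>i\<in>C. \<forall>j\<in>Q. j < i \<longrightarrow> j \<in> C)"
  proof
    assume "C \<subseteq> Q \<and> card C = c \<and> (\<forall>i\<in>C. \<forall>j\<in>Q. j < i \<longrightarrow> j \<in> C)"
    then show "C = T"
      using T initial_segments_eq[OF Q(2), of C T] by simp
  qed (use T in simp)
  moreover have "SCG_tuple d k w S N C \<longleftrightarrow>
      S \<subseteq> {1..d} \<and> N \<subseteq> {1..d} \<and> S \<inter> N = {} \<and> card S \<le> k \<and> C = T"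
    unfolding SCG_tuple_def Let_def T_def c_def Q_def R_def ..
  ultimately show ?thesis
    by (simp only: c_def Q_def)
qed

section \<open>Two families of minimal SCG-tuples\<close>

lemma minimal_SCG_tuple_small:
  assumes w: "strict_antimono_on {1..d} w"
    and U: "U \<subseteq> {1..d}" "card U < k"
    and valid: "(\<Sum>i\<in>U. w i) < knapsack_capacity d k \<gamma> gap w"
  shows "minimal_SCG_tuple d k \<gamma> gap w {} ({1..d} - U) U"
proof -
  have R: "{1..d} - ({} \<union> ({1..d} - U)) = U"
    using U by auto
  have "SCG_tuple d k w {} ({1..d} - U) U"
    unfolding SCG_tuple_iff[OF w] R using U by simp
  moreover have "\<not> SCG_tuple d k w {} ({1..d} - U - {i}) U" if "i \<in> {1..d} - U" for i
  proof -
    have R': "{1..d} - ({} \<union> ({1..d} - U - {i})) = insert i U"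
      using U that by auto
    \<comment> \<open>As \<open>card U < k\<close>, the bound \<open>k\<close> still admits the
      whole enlarged remainder \<open>insert i U\<close>, so the third component would need one
      element more than \<open>U\<close> has.\<close>
    have "card (insert i U) = Suc (card U)"
      using U that finite_subset[OF U(1)] by simp
    then show ?thesis
      using U unfolding SCG_tuple_iff[OF w] R' by simp
  qed
  ultimately show ?thesis
    using valid by (auto simp: minimal_SCG_tuple_def valid_SCG_tuple_def knapsack_capacity_def)
qed

text \<open>Since \<open>card U = k\<close>, the part of \<open>U\<close> up to \<open>t\<close> has
  exactly the \<open>k - card S\<close> elements required of \<open>C\<close>. Indices outside
  \<open>U\<close> below \<open>t\<close> go to \<open>N\<close>, so that they do not interrupt the
  initial segment; those above \<open>t\<close> stay in the remainder. The cut \<open>t = 0\<close>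
  puts all of \<open>U\<close> into \<open>S\<close>.\<close>

lemma minimal_SCG_tuple_threshold:
  fixes t :: nat
  assumes w: "strict_antimono_on {1..d} w"
    and U: "U \<subseteq> {1..d}" "card U = k"
    and valid: "(\<Sum>i\<in>U. w i) < knapsack_capacity d k \<gamma> gap w"
    and t: "t = 0 \<or> t \<in> U"
    and gap: "\<And>i. i \<in> U \<Longrightarrow> t < i \<Longrightarrow> \<exists>b. t < b \<and> b < i \<and> b \<notin> U"
  shows "minimal_SCG_tuple d k \<gamma> gap w {i \<in> U. t < i} ({1..t} - U) {i \<in> U. i \<le> t}"
    (is "minimal_SCG_tuple d k \<gamma> gap w ?S ?N ?C")
proof -
  have fin: "finite U"
    using U(1) finite_subset by blast
  have td: "t \<le> d"
    using t U by auto
  have SC: "?S \<union> ?C = U" "?S \<inter> ?C = {}"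
    by auto
  have card: "card ?S + card ?C = k"
    using card_Un_disjoint[of ?S ?C] fin U SC by simp
  have sum: "sum w ?S + sum w ?C = sum w U"
    using sum.union_disjoint[of ?S ?C w] fin SC by simp
  have CR: "?C \<subseteq> {1..d} - (?S \<union> ?N)"
    using U by auto
  have "card ?C \<le> card ({1..d} - (?S \<union> ?N))"
    using CR by (intro card_mono) auto
  moreover have "?S \<subseteq> {1..d}" "?N \<subseteq> {1..d}" "?S \<inter> ?N = {}"
    using U td by auto
  moreover have "\<forall>i\<in>?C. \<forall>j\<in>{1..d} - (?S \<union> ?N). j < i \<longrightarrow> j \<in> ?C"
    by auto
  ultimately have scg: "SCG_tuple d k w ?S ?N ?C"
    unfolding SCG_tuple_iff[OF w] using CR card by auto
  have N: "\<not> SCG_tuple d k w ?S (?N - {i}) ?C" if i: "i \<in> ?N" for i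
  proof
    assume "SCG_tuple d k w ?S (?N - {i}) ?C"
    then have "\<forall>i'\<in>?C. \<forall>j\<in>{1..d} - (?S \<union> (?N - {i})). j < i' \<longrightarrow> j \<in> ?C"
      unfolding SCG_tuple_iff[OF w] by blast
    \<comment> \<open>A released \<open>i\<close> lies in \<open>{1..t}\<close>, so \<open>t\<close>
      is not 0 and therefore belongs to \<open>U\<close>; as \<open>i\<close> is outside
      \<open>U\<close>, it is strictly below \<open>t\<close>.\<close>
    moreover have "t \<in> ?C" "i < t" "i \<in> {1..d} - (?S \<union> (?N - {i}))" "i \<notin> ?C"
      using i t td by (auto simp: le_less)
    ultimately show False
      by blast
  qed
  have S: "\<not> SCG_tuple d k w (?S - {i}) ?N (?C \<union> {i})" if i: "i \<in> ?S" for i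
  proof
    assume "SCG_tuple d k w (?S - {i}) ?N (?C \<union> {i})"
    then have closed: "j \<in> {1..d} - (?S - {i} \<union> ?N) \<Longrightarrow> j < i \<Longrightarrow> j \<in> ?C \<union> {i}" for j
      unfolding SCG_tuple_iff[OF w] by blast
    obtain b where b: "t < b" "b < i" "b \<notin> U"
      using gap i by blast
    moreover have "i \<le> d"
      using i U by auto
    \<comment> \<open>Being beyond \<open>t\<close> and outside \<open>U\<close>, \<open>b\<close>
      is in none of \<open>S\<close>, \<open>N\<close> and \<open>C\<close>; it remains available
      below the moved index \<open>i\<close>.\<close>
    ultimately have "b \<in> {1..d} - (?S - {i} \<union> ?N)" "b \<notin> ?C \<union> {i}"
      using b by auto
    then show False
      using closed b by blast
  qed
  show ?thesis
    using scg N S sum valid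
    by (auto simp: minimal_SCG_tuple_def valid_SCG_tuple_def knapsack_capacity_def)
qed

subsection \<open>Minimum consecutive partitions\<close>

text \<open>Stepping through an interval inside \<open>I\<close> never leaves a block of
  \<open>P\<close>, by \<open>closed\<close>. Hence every consecutive partition \<open>Q\<close>
  refines \<open>P\<close>, and sending each block of \<open>Q\<close> to the block of
  \<open>P\<close> around it is a map onto \<open>P\<close>.\<close>

lemma min_consecutive_partitionI:
  assumes P: "consecutive_partition d I P" and "finite I"
    and closed: "\<And>X x. X \<in> P \<Longrightarrow> x \<in> X \<Longrightarrow> Suc x \<in> I \<Longrightarrow> Suc x \<in> X"
  shows "min_consecutive_partition d I P"
  unfolding min_consecutive_partition_def
proof (intro conjI allI impI P)
  fix Q assume Q: "consecutive_partition d I Q"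
  have part: "partition_on I P" "partition_on I Q"
    using P Q by (auto simp: consecutive_partition_def)
  have "finite Q"
    using \<open>finite I\<close> part(2) by (rule finite_elements)
  have inside: "\<exists>X\<in>P. Y \<subseteq> X" if "Y \<in> Q" for Y
  proof -
    obtain a b where Y: "a \<le> b" "Y = {a..b}"
      using Q \<open>Y \<in> Q\<close> unfolding consecutive_partition_def consecutive_set_def by blast
    have YI: "Y \<subseteq> I"
      using part(2) \<open>Y \<in> Q\<close> partition_onD1 by blast
    then obtain X where X: "X \<in> P" "a \<in> X"
      using part(1) Y partition_onD1[OF part(1)] by auto
    have "i \<le> b \<Longrightarrow> i \<in> X" if "a \<le> i" for i
      using that
    proof (induction i rule: dec_induct)
      case (step n)
      then show ?case
        using closed[OF X(1), of n] subsetD[OF YI, of "Suc n"] Y by auto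
    qed (use X in simp)
    then show ?thesis
      using X Y by (intro bexI[of _ X]) auto
  qed
  then obtain f where f: "\<And>Y. Y \<in> Q \<Longrightarrow> f Y \<in> P \<and> Y \<subseteq> f Y"
    by metis
  have "P \<subseteq> f ` Q"
  proof
    fix X assume "X \<in> P"
    then have "X \<noteq> {}" "X \<subseteq> I"
      using partition_onD1[OF part(1)] partition_onD3[OF part(1)] by auto
    then obtain x where x: "x \<in> X" "x \<in> I"
      by blast
    then obtain Y where Y: "Y \<in> Q" "x \<in> Y"
      using partition_onD1[OF part(2)] by auto
    then have "f Y \<in> P" "x \<in> f Y"
      using f by auto
    then have "f Y = X"
      using x \<open>X \<in> P\<close> disjointD[OF partition_onD2[OF part(1)]] by blast
    then show "X \<in> f ` Q"
      using Y by blast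
  qed
  then show "card P \<le> card Q"
    using \<open>finite Q\<close> by (meson card_image_le card_mono finite_imageI order_trans)
qed

text \<open>Two adjacent blocks could be merged into the single interval \<open>{a..e}\<close>,
  giving a consecutive partition with fewer blocks.\<close>

lemma min_consecutive_partition_separated:
  assumes P: "min_consecutive_partition d I P" and "finite I"
    and X: "{a..b} \<in> P" and Y: "{Suc b..e} \<in> P" and "a \<le> b" "Suc b \<le> e"
  shows False
proof -
  let ?X = "{a..b}" and ?Y = "{Suc b..e}"
  let ?Q = "insert {a..e} (P - {?X, ?Y})"
  have part: "partition_on I P" and cons: "\<And>Z. Z \<in> P \<Longrightarrow> consecutive_set d Z"
    using P by (auto simp: min_consecutive_partition_def consecutive_partition_def)
  have "finite P"
    using \<open>finite I\<close> part by (rule finite_elements)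
  have XY: "{a..e} = ?X \<union> ?Y"
    using \<open>a \<le> b\<close> \<open>Suc b \<le> e\<close> by auto
  have ne: "?X \<noteq> ?Y"
    using \<open>a \<le> b\<close> by (metis atLeastAtMost_iff not_less_eq_eq order_refl)
  have "partition_on I ?Q"
  proof (rule partition_onI)
    show "\<Union>?Q = I"
      using partition_onD1[OF part] X Y XY by blast
    show "disjnt p q" if "p \<in> ?Q" "q \<in> ?Q" "p \<noteq> q" for p q
      using that X Y partition_onD2[OF part] unfolding XY disjoint_def disjnt_def
      by (smt (verit, ccfv_threshold) Diff_iff Int_Un_distrib Int_commute Un_empty insertCI insert_iff)
    show "{} \<notin> ?Q"
      using partition_onD3[OF part] \<open>a \<le> b\<close> \<open>Suc b \<le> e\<close> by auto
  qed
  moreover have "consecutive_set d {a..e}"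
  proof -
    have "?X \<subseteq> {1..d}" "?Y \<subseteq> {1..d}"
      using cons[OF X] cons[OF Y] unfolding consecutive_set_def by auto
    then have "1 \<le> a" "e \<le> d"
      using \<open>a \<le> b\<close> \<open>Suc b \<le> e\<close> by auto
    then show ?thesis
      using \<open>a \<le> b\<close> \<open>Suc b \<le> e\<close> unfolding consecutive_set_def
      by (intro exI[of _ a] exI[of _ e]) auto
  qed
  ultimately have "consecutive_partition d I ?Q"
    using cons by (auto simp: consecutive_partition_def)
  then have "card P \<le> card ?Q"
    using P by (simp add: min_consecutive_partition_def)
  also have "\<dots> \<le> Suc (card (P - {?X, ?Y}))"
    by (rule card_insert_le_m1) auto
  also have "\<dots> = Suc (card P - 2)"
    using X Y ne \<open>finite P\<close> by (subst card_Diff_subset) auto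
  \<comment> \<open>The two distinct blocks give \<open>card P\<close> at least 2, so the truncated
    subtraction is exact.\<close>
  also have "\<dots> < card P"
    using card_mono[OF \<open>finite P\<close>, of "{?X, ?Y}"] X Y ne by simp
  finally show False
    by simp
qed

section \<open>Positions of the blocks and of the gaps between them\<close>

locale consecutive_blocks =
  fixes d m :: nat and U :: "nat set" and A :: "nat \<Rightarrow> nat set"
  assumes blocks: "min_consecutive_blocks d U m A"
begin

text \<open>These are the thresholds at which \<open>U\<close> is cut. The value 0 at
  \<open>l = 0\<close> encodes the convention for the maximum of \<open>A 0\<close> and lets all
  \<open>l\<close> from 0 to \<open>m\<close> be treated uniformly.\<close>

definition block_end :: "nat \<Rightarrow> nat" where
  "block_end l = (if l = 0 then 0 else Max (A l))"

lemma partition: "partition_on U (A ` {1..m})"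
  using blocks by (auto simp: min_consecutive_blocks_def min_consecutive_partition_def
      consecutive_partition_def)

lemma U_eq: "U = (\<Union>j\<in>{1..m}. A j)"
  using partition_onD1[OF partition] by simp

lemma block_consecutive: "j \<in> {1..m} \<Longrightarrow> consecutive_set d (A j)"
  using blocks by (auto simp: min_consecutive_blocks_def min_consecutive_partition_def
      consecutive_partition_def)

lemma block_interval:
  assumes "j \<in> {1..m}"
  shows "A j = {Min (A j)..Max (A j)}" "Min (A j) \<le> Max (A j)" "1 \<le> Min (A j)" "Max (A j) \<le> d"
proof -
  obtain a b where ab: "1 \<le> a" "a \<le> b" "b \<le> d" "A j = {a..b}"
    using block_consecutive[OF assms] by (auto simp: consecutive_set_def)
  moreover have "Min {a..b} = a" "Max {a..b} = b"
    using \<open>a \<le> b\<close> by (auto intro: Min_eqI Max_eqI)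
  ultimately show "A j = {Min (A j)..Max (A j)}" "Min (A j) \<le> Max (A j)"
    "1 \<le> Min (A j)" "Max (A j) \<le> d"
    by auto
qed

lemma mem_block: "j \<in> {1..m} \<Longrightarrow> i \<in> A j \<longleftrightarrow> Min (A j) \<le> i \<and> i \<le> Max (A j)"
  using block_interval(1)[of j] by (metis atLeastAtMost_iff)

lemma U_subset: "U \<subseteq> {1..d}"
  using block_interval(3,4) mem_block by (fastforce simp: U_eq)

lemma finite_U: "finite U"
  using U_subset finite_subset by blast

lemma block_less: "i \<in> {1..m} \<Longrightarrow> j \<in> {1..m} \<Longrightarrow> i < j \<Longrightarrow> Max (A i) < Min (A j)"
  using blocks by (auto simp: min_consecutive_blocks_def)

text \<open>The minima of the blocks are \<open>m\<close> different elements of \<open>U\<close>.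
  This yields \<open>m \<le> k\<close> in the theorem.\<close>

lemma card_le: "m \<le> card U"
proof -
  have "inj_on (\<lambda>j. Min (A j)) {1..m}"
  proof (rule linorder_inj_onI)
    fix i j assume "i < j" "i \<in> {1..m}" "j \<in> {1..m}"
    then show "Min (A i) \<noteq> Min (A j)"
      using block_less[of i j] block_interval(2)[of i] by auto
  qed auto
  moreover have "(\<lambda>j. Min (A j)) ` {1..m} \<subseteq> U"
    using mem_block block_interval(2) by (fastforce simp: U_eq)
  ultimately show ?thesis
    using card_inj_on_le finite_U by fastforce
qed

text \<open>The ordering of the blocks only gives \<open>Max (A l) < Min (A (Suc l))\<close>;
  touching blocks are excluded by the minimality of the partition, which enters here.\<close>

lemma block_gap:
  assumes "1 \<le> l" "Suc l \<le> m"
  shows "Suc (Max (A l)) < Min (A (Suc l))"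
proof (rule ccontr)
  assume "\<not> ?thesis"
  then have "Min (A (Suc l)) = Suc (Max (A l))"
    using block_less[of l "Suc l"] assms by simp
  then show False
    using min_consecutive_partition_separated[of d U "A ` {1..m}" "Min (A l)" "Max (A l)"
        "Max (A (Suc l))"] blocks finite_U assms block_interval(1,2)[of l]
        block_interval(1,2)[of "Suc l"]
    by (auto simp: min_consecutive_blocks_def)
qed

lemma block_end_less_Min: "Suc l \<le> m \<Longrightarrow> block_end l < Min (A (Suc l))"
  using block_less[of l "Suc l"] block_interval(3)[of "Suc l"] by (auto simp: block_end_def)

lemma block_end_mono:
  assumes "i \<le> j" "j \<le> m"
  shows "block_end i \<le> block_end j"
proof (cases "i = 0 \<or> i = j")
  case False
  then show ?thesis
    using block_less[of i j] block_interval(2)[of j] assms by (simp add: block_end_def)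
qed (auto simp: block_end_def)

lemma block_end_mem: "l \<le> m \<Longrightarrow> block_end l = 0 \<or> block_end l \<in> U"
  using mem_block[of l "block_end l"] block_interval(2)[of l]
  by (auto simp: block_end_def U_eq)

lemma gap_block_Suc: "gap_block A (Suc l) = {Suc (block_end l)..Min (A (Suc l)) - 1}"
  by (simp add: gap_block_def block_end_def)

lemma mem_gap_block_Suc:
  "Suc l \<le> m \<Longrightarrow> i \<in> gap_block A (Suc l) \<longleftrightarrow> block_end l < i \<and> i < Min (A (Suc l))"
  unfolding gap_block_Suc using block_end_less_Min[of l] by auto

text \<open>No threshold cuts through a block. This translates block indices into positions, so that
  unions of blocks become the parts of \<open>U\<close> on either side of a threshold.\<close>

lemma mem_block_le_iff:
  assumes "l \<le> m" "j \<in> {1..m}" "i \<in> A j"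
  shows "i \<le> block_end l \<longleftrightarrow> j \<le> l"
proof
  assume "i \<le> block_end l"
  show "j \<le> l"
  proof (rule ccontr)
    assume "\<not> j \<le> l"
    then have "block_end l < Min (A j)"
      using block_less[of l j] block_interval(3)[of j] assms by (auto simp: block_end_def)
    then show False
      using \<open>i \<le> block_end l\<close> assms mem_block by fastforce
  qed
next
  assume "j \<le> l"
  then show "i \<le> block_end l"
    using block_end_mono[of j l] assms mem_block[of j i] by (auto simp: block_end_def)
qed

lemma blocks_le: "l \<le> m \<Longrightarrow> (\<Union>j\<in>{1..l}. A j) = {i \<in> U. i \<le> block_end l}"
  using mem_block_le_iff by (fastforce simp: U_eq)

lemma blocks_greater:
  assumes "l \<le> m"
  shows "(\<Union>j\<in>{l + 1..m}. A j) = {i \<in> U. block_end l < i}"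
proof (intro set_eqI iffI)
  fix i assume "i \<in> (\<Union>j\<in>{l + 1..m}. A j)"
  then obtain j where "j \<in> {l + 1..m}" "i \<in> A j"
    by blast
  then show "i \<in> {i \<in> U. block_end l < i}"
    using mem_block_le_iff[OF assms, of j i] by (auto simp: U_eq)
next
  fix i assume "i \<in> {i \<in> U. block_end l < i}"
  then obtain j where "j \<in> {1..m}" "i \<in> A j" "block_end l < i"
    unfolding U_eq by blast
  then show "i \<in> (\<Union>j\<in>{l + 1..m}. A j)"
    using mem_block_le_iff[OF assms, of j i] by auto
qed

lemma gap_block_disjoint: "Suc l \<le> m \<Longrightarrow> gap_block A (Suc l) \<inter> U = {}"
proof (rule ccontr)
  assume l: "Suc l \<le> m" and "gap_block A (Suc l) \<inter> U \<noteq> {}"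
  then obtain i j where ij: "i \<in> gap_block A (Suc l)" "j \<in> {1..m}" "i \<in> A j"
    unfolding U_eq by blast
  then have i: "block_end l < i" "i < Min (A (Suc l))"
    using l by (auto simp: mem_gap_block_Suc)
  have "i \<le> block_end (Suc l)"
    using i block_interval(2)[of "Suc l"] l by (simp add: block_end_def)
  then have "j = Suc l"
    using mem_block_le_iff[of l j i] mem_block_le_iff[of "Suc l" j i] i ij l by simp
  then show False
    using i ij mem_block by fastforce
qed

lemma gap_blocks: "l \<le> m \<Longrightarrow> (\<Union>j\<in>{1..l}. gap_block A j) = {1..block_end l} - U"
proof (induction l)
  case (Suc l)
  have "(\<Union>j\<in>{1..Suc l}. gap_block A j) = ({1..block_end l} - U) \<union> gap_block A (Suc l)"
    using Suc by (auto simp: atLeastAtMostSuc_conv)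
  also have "\<dots> = {1..block_end (Suc l)} - U"
  proof -
    \<comment> \<open>Between two successive thresholds, the positions from
      \<open>Min (A (Suc l))\<close> on form a block and the earlier ones form the gap.\<close>
    have "i \<in> gap_block A (Suc l) \<longleftrightarrow> i \<in> {Suc (block_end l)..block_end (Suc l)} - U" for i
    proof -
      have "i \<in> U" if "Min (A (Suc l)) \<le> i" "i \<le> block_end (Suc l)"
        using that Suc.prems mem_block[of "Suc l" i] by (auto simp: U_eq block_end_def)
      moreover have "Min (A (Suc l)) \<le> block_end (Suc l)"
        using block_interval(2)[of "Suc l"] Suc.prems by (simp add: block_end_def)
      ultimately show ?thesis
        using gap_block_disjoint[OF Suc.prems] mem_gap_block_Suc[OF Suc.prems, of i]
        by (cases "Min (A (Suc l)) \<le> i") auto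
    qed
    moreover have "block_end l \<le> block_end (Suc l)"
      using block_end_mono Suc.prems by simp
    ultimately show ?thesis
      by fastforce
  qed
  finally show ?case .
qed (simp add: block_end_def)

section \<open>The set \<open>comp_set d U\<close> and its minimum consecutive partition\<close>

lemma comp_eq: "comp_set d U = {1..block_end m} - U"
proof -
  \<comment> \<open>\<open>block_end m\<close> is the largest element of \<open>U\<close>, or 0 when
    \<open>U\<close> is empty.\<close>
  have "(\<exists>j\<in>U. i < j) \<longleftrightarrow> i < block_end m" if "i \<notin> U" for i
  proof
    assume "\<exists>j\<in>U. i < j"
    then show "i < block_end m"
      using blocks_le[of m] U_eq by force
  next
    assume "i < block_end m"
    then show "\<exists>j\<in>U. i < j"
      using block_end_mem[of m] by auto
  qed
  moreover have "block_end m \<le> d"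
    using block_end_mem[of m] U_subset by auto
  moreover have "i \<noteq> block_end m" if "i \<notin> U" "1 \<le> i" for i
    using block_end_mem[of m] that by auto
  ultimately show ?thesis
    by (fastforce simp: comp_set_def)
qed

lemma comp_eq_gap_blocks: "comp_set d U = (\<Union>j\<in>{1..m}. gap_block A j)"
  unfolding comp_eq using gap_blocks[of m] by simp

lemma gap_block_cases:
  assumes "X \<in> gap_block A ` {1..m} - {{}}"
  obtains l where "Suc l \<le> m" "X = gap_block A (Suc l)" "X \<noteq> {}"
proof -
  obtain j where "j \<in> {1..m}" "X = gap_block A j" "X \<noteq> {}"
    using assms by blast
  then show thesis
    using that[of "j - 1"] by simp
qed

lemma gap_blocks_disjoint:
  assumes "Suc l < Suc l'" "Suc l' \<le> m"
  shows "gap_block A (Suc l) \<inter> gap_block A (Suc l') = {}"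
proof -
  have "Min (A (Suc l)) \<le> block_end (Suc l)"
    using block_interval(2)[of "Suc l"] assms by (simp add: block_end_def)
  also have "\<dots> \<le> block_end l'"
    using block_end_mono assms by simp
  finally show ?thesis
    using assms by (auto simp: mem_gap_block_Suc)
qed

text \<open>Each gap is followed immediately by the minimum of a block, which lies in
  \<open>U\<close>, so a successor that stays in the complement stays in the same gap. The empty set
  is removed because \<open>gap_block A 1\<close> may be empty.\<close>

lemma min_partition_comp:
  "min_consecutive_partition d (comp_set d U) (gap_block A ` {1..m} - {{}})"
  (is "min_consecutive_partition d ?I ?P")
proof (rule min_consecutive_partitionI)
  show "finite ?I"
    by (simp add: comp_eq)
  have "partition_on ?I ?P"
  proof (rule partition_onI)
    show "\<Union>?P = ?I"
      by (auto simp: comp_eq_gap_blocks)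
    fix X Y assume XY: "X \<in> ?P" "Y \<in> ?P" "X \<noteq> Y"
    then obtain l l' where "Suc l \<le> m" "X = gap_block A (Suc l)"
      "Suc l' \<le> m" "Y = gap_block A (Suc l')"
      by (elim gap_block_cases)
    then show "disjnt X Y"
      using XY gap_blocks_disjoint[of l l'] gap_blocks_disjoint[of l' l]
      unfolding disjnt_def by (cases l l' rule: linorder_cases) auto
  qed simp
  moreover have "consecutive_set d X" if X: "X \<in> ?P" for X
  proof -
    obtain l where l: "Suc l \<le> m" "X = gap_block A (Suc l)" "X \<noteq> {}"
      using X by (rule gap_block_cases)
    moreover have "Min (A (Suc l)) - 1 \<le> d"
      using block_interval(2,4)[of "Suc l"] l by simp
    ultimately show ?thesis
      unfolding consecutive_set_def gap_block_Suc
      by (intro exI[of _ "Suc (block_end l)"] exI[of _ "Min (A (Suc l)) - 1"]) auto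
  qed
  ultimately show "consecutive_partition d ?I ?P"
    by (simp add: consecutive_partition_def)
  fix X x assume X: "X \<in> ?P" and x: "x \<in> X" "Suc x \<in> ?I"
  obtain l where l: "Suc l \<le> m" "X = gap_block A (Suc l)"
    by (rule gap_block_cases[OF X])
  have "Min (A (Suc l)) \<in> U"
    using l mem_block[of "Suc l" "Min (A (Suc l))"] block_interval(2)[of "Suc l"]
    by (auto simp: U_eq)
  moreover have "Suc x \<notin> U"
    using x by (simp add: comp_set_def)
  ultimately have "Suc x \<noteq> Min (A (Suc l))"
    by metis
  then show "Suc x \<in> X"
    using x l by (auto simp: mem_gap_block_Suc)
qed

section \<open>Minimal SCG-tuples obtained by cutting at block ends\<close>

lemma separating_index:
  assumes l: "l \<le> m" "l = 0 \<Longrightarrow> gap_block A 1 \<noteq> {}" and i: "i \<in> U" "block_end l < i"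
  shows "\<exists>b. block_end l < b \<and> b < i \<and> b \<notin> U"
proof -
  obtain j where j: "j \<in> {1..m}" "i \<in> A j"
    using i by (auto simp: U_eq)
  then have "l < j"
    using mem_block_le_iff[OF l(1) j] i by simp
  then have m: "Suc l \<le> m"
    using j by simp
  \<comment> \<open>For positive \<open>l\<close> consecutive blocks do not touch; for
    \<open>l = 0\<close> this is the extra hypothesis on the first gap.\<close>
  have "gap_block A (Suc l) \<noteq> {}"
  proof (cases "l = 0")
    case False
    then have "Suc (Max (A l)) \<in> gap_block A (Suc l)"
      using block_gap[of l] m by (simp add: mem_gap_block_Suc) (simp add: block_end_def)
    then show ?thesis
      by blast
  qed (use l(2) in simp)
  then obtain b where b: "b \<in> gap_block A (Suc l)"
    by blast
  \<comment> \<open>\<open>i\<close> lies in block \<open>Suc l\<close> or a later one, so the whole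
    gap before block \<open>Suc l\<close> is below \<open>i\<close>.\<close>
  moreover have "Min (A (Suc l)) \<le> i"
    using \<open>l < j\<close> j m mem_block[of j i] block_less[of "Suc l" j] block_interval(2)[of "Suc l"]
    by (cases "j = Suc l") auto
  ultimately show ?thesis
    using m gap_block_disjoint[OF m] by (intro exI[of _ b]) (auto simp: mem_gap_block_Suc)
qed

text \<open>The three unions are the threshold sets for \<open>t = block_end l\<close>, so one
  statement covers the interior cuts and both extremes \<open>l = 0\<close> and
  \<open>l = m\<close>.\<close>

lemma minimal_SCG_tuple_blocks:
  assumes "strict_antimono_on {1..d} w" "card U = k"
    and "(\<Sum>i\<in>U. w i) < knapsack_capacity d k \<gamma> gap w"
    and "l \<le> m" "l = 0 \<Longrightarrow> gap_block A 1 \<noteq> {}"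
  shows "minimal_SCG_tuple d k \<gamma> gap w
    (\<Union>j\<in>{l + 1..m}. A j) (\<Union>j\<in>{1..l}. gap_block A j) (\<Union>j\<in>{1..l}. A j)"
  unfolding blocks_le[OF assms(4)] blocks_greater[OF assms(4)] gap_blocks[OF assms(4)]
  using assms U_subset block_end_mem separating_index
  by (intro minimal_SCG_tuple_threshold) auto

end

section \<open>From the regression data to the combinatorial setting\<close>

lemma decreasing_reordering_strict:
  fixes u :: "real ^ 'n"
  assumes "decreasing_reordering u w" "inj_on w {1..CARD('n)}"
  shows "strict_antimono_on {1..CARD('n)} w"
  using assms unfolding decreasing_reordering_def monotone_on_def inj_on_def
  by (metis less_le)

text \<open>A nonzero value of \<open>y\<close> is 1. This turns the knapsack constraint on
  \<open>y\<close> into the validity inequality for tuples with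
  \<open>S \<union> C = supp d y\<close>.\<close>

lemma sum_binary_eq_sum_supp:
  assumes "y \<in> {1..d} \<rightarrow>\<^sub>E {0, 1}"
  shows "(\<Sum>i=1..d. w i * y i) = (\<Sum>i\<in>supp d y. w i)"
proof -
  have "(\<Sum>i=1..d. w i * y i) = (\<Sum>i\<in>supp d y. w i * y i)"
    by (rule sum.mono_neutral_right) (auto simp: supp_def)
  also have "\<dots> = (\<Sum>i\<in>supp d y. w i)"
    using PiE_mem[OF assms] by (intro sum.cong) (fastforce simp: supp_def)+
  finally show ?thesis .
qed

theorem proposition4:
  fixes L :: "real ^ 'n \<Rightarrow> real" and \<gamma> v_ub gap :: real and d k m :: nat
    and p_hat w_hat :: "real ^ 'n" and w y :: "nat \<Rightarrow> real" and A B :: "nat \<Rightarrow> nat set"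
  assumes "d = CARD('n)" and "1 \<le> k" and "k \<le> d"
    and "convex_on UNIV L" and "\<gamma> > 0"
    and "conic_inner_value L \<gamma> k p_hat = conic_value L \<gamma> k"
    and "w_hat = (\<chi> i. p_hat $ i * p_hat $ i)"
    and "sparse_ridge_value L \<gamma> k \<le> ereal v_ub"
    and "ereal gap = ereal v_ub - conic_value L \<gamma> k"
    and "decreasing_reordering w_hat w"
    and "inj_on w {1..d}"
    and "y \<in> knapsack_set d k \<gamma> gap w"
    and "y \<noteq> (\<lambda>i\<in>{1..d}. 0)"
    and "min_consecutive_blocks d (supp d y) m A"
    and "B = gap_block A"
  shows
    "m \<le> k \<and>
     comp_set d (supp d y) = (\<Union>j\<in>{1..m}. B j) \<and>
     min_consecutive_partition d (comp_set d (supp d y)) (B ` {1..m} - {{}}) \<and>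
     (card (supp d y) < k \<longrightarrow>
        minimal_SCG_tuple d k \<gamma> gap w {} ({1..d} - supp d y) (supp d y)) \<and>
     (card (supp d y) = k \<longrightarrow>
        (\<forall>l\<in>{1..m - 1}.
           (\<Union>j\<in>{l + 1..m}. A j) \<union> (\<Union>j\<in>{1..l}. A j) = supp d y \<and>
           minimal_SCG_tuple d k \<gamma> gap w
             (\<Union>j\<in>{l + 1..m}. A j) (\<Union>j\<in>{1..l}. B j) (\<Union>j\<in>{1..l}. A j)) \<and>
        minimal_SCG_tuple d k \<gamma> gap w {} (comp_set d (supp d y)) (supp d y) \<and>
        (B 1 \<noteq> {} \<longrightarrow> minimal_SCG_tuple d k \<gamma> gap w (supp d y) {} {}))"
proof -
  interpret consecutive_blocks d m "supp d y" A
    by unfold_locales fact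
  have w: "strict_antimono_on {1..d} w"
    using assms by (blast intro: decreasing_reordering_strict)
  have k: "card (supp d y) \<le> k" and cap: "(\<Sum>i\<in>supp d y. w i) < knapsack_capacity d k \<gamma> gap w"
    using assms(12) by (auto simp: knapsack_set_def simp flip: sum_binary_eq_sum_supp)
  have tuples: "minimal_SCG_tuple d k \<gamma> gap w
      (\<Union>j\<in>{l + 1..m}. A j) (\<Union>j\<in>{1..l}. B j) (\<Union>j\<in>{1..l}. A j)"
    if "card (supp d y) = k" "l \<le> m" "l = 0 \<Longrightarrow> B 1 \<noteq> {}" for l
    using minimal_SCG_tuple_blocks[OF w _ cap] that \<open>B = gap_block A\<close> by simp
  \<comment> \<open>With \<open>m\<close> positive, the case \<open>l = m\<close> below is free of
    the condition on \<open>B 1\<close>.\<close>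
  have "m \<noteq> 0"
    if "card (supp d y) = k"
  proof
    assume "m = 0"
    then have "supp d y = {}"
      using U_eq by simp
    then show False
      using that \<open>1 \<le> k\<close> by simp
  qed
  then have "minimal_SCG_tuple d k \<gamma> gap w {} (comp_set d (supp d y)) (supp d y)"
    if "card (supp d y) = k"
    using tuples[of m] that comp_eq_gap_blocks U_eq \<open>B = gap_block A\<close> by simp
  \<comment> \<open>At \<open>l = 0\<close> the unions over \<open>{1..0}\<close> are empty and all
    blocks go to \<open>S\<close>.\<close>
  moreover have "minimal_SCG_tuple d k \<gamma> gap w (supp d y) {} {}"
    if "card (supp d y) = k" "B 1 \<noteq> {}"
    using tuples[of 0] that U_eq by simp
  moreover have "(\<Union>j\<in>{l + 1..m}. A j) \<union> (\<Union>j\<in>{1..l}. A j) = supp d y" if "l \<in> {1..m - 1}" for l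
  proof -
    have "l \<le> m"
      using that by auto
    then show ?thesis
      unfolding blocks_le[OF \<open>l \<le> m\<close>] blocks_greater[OF \<open>l \<le> m\<close>] by auto
  qed
  moreover have "minimal_SCG_tuple d k \<gamma> gap w {} ({1..d} - supp d y) (supp d y)"
    if "card (supp d y) < k"
    using minimal_SCG_tuple_small[OF w U_subset that cap] .
  moreover have "minimal_SCG_tuple d k \<gamma> gap w
      (\<Union>j\<in>{l + 1..m}. A j) (\<Union>j\<in>{1..l}. B j) (\<Union>j\<in>{1..l}. A j)"
    if "card (supp d y) = k" "l \<in> {1..m - 1}" for l
    using that by (intro tuples) auto
  moreover have "m \<le> k"
    using card_le k by simp
  ultimately show ?thesis
    using comp_eq_gap_blocks min_partition_comp \<open>B = gap_block A\<close> by simp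
qed

end
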